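(* Let $0<\alpha<4\beta<\infty$ and $\lambda\in\left(0,2-\frac{\alpha}{2\beta}\right)$. Let $H$ be a real Hilbert space, let $A\colon H\rightrightarrows H$ and $B\colon H\rightrightarrows H$ be monotone, and let $C\colon H\rightrightarrows H$ be $\beta$-cocoercive. (1) If $A$ is $L_A$-Lipschitz and $C$ is $\mu_C$-strongly monotone with $L_A\in(0,\infty)$ and $0<\mu_C\le\frac1\beta$, then $T_{A,B,C,\alpha,\lambda}$ is $\rho$-contractive with $$\rho=\sqrt{1-2\lambda\alpha\min\left\{\frac{L_A+\mu_C\left(1-\frac{\alpha}{2\beta(2-\lambda)}\right)}{(1+\alpha L_A)^2},\ \frac{\mu_C\left(1-\frac{\alpha}{2\beta(2-\lambda)}\right)}{1+\alpha^2L_A^2}\right\}}.$$ (2) Symmetrically, if $B$ is $L_B$-Lipschitz and $C$ is $\mu_C$-strongly monotone with $L_B\in(0,\infty)$ and $0<\mu_C\le\frac1\beta$, then $T_{A,B,C,\alpha,\lambda}$ is $\rho$-contractive with $$\rho=\sqrt{1-2\lambda\alpha\min\left\{\frac{L_B+\mu_C\left(1-\frac{\alpha}{2\beta(2-\lambda)}\right)}{(1+\alpha L_B)^2},\ \frac{\mu_C\left(1-\frac{\alpha}{2\beta(2-\lambda)}\right)}{1+\alpha^2L_B^2}\right\}}.$$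
   Context: A (multi-valued) operator $A\colon H\rightrightarrows H$ is identified with its graph, a subset of $H\times H$; $u\in Ax$ means $(x,u)\in A$, and $\mathrm{dom}\,A=\{x:Ax\ne\emptyset\}$. Operators need not have full domain and monotone operators need not be maximal. Set $A^{-1}=\{(u,x):(x,u)\in A\}$, $A+B=\{(x,u+v):(x,u)\in A,(x,v)\in B\}$, $AB=\{(x,s):\exists u,\ (x,u)\in B,\ (u,s)\in A\}$, $I$ the identity, and $J_{\alpha A}=(I+\alpha A)^{-1}$ the resolvent. For all $u\in Ax$, $v\in Ay$: $A$ is monotone if $\langle x-y,u-v\rangle\ge0$; $\mu$-strongly monotone if $\langle x-y,u-v\rangle\ge\mu\|x-y\|^2$; $L$-Lipschitz if $\|u-v\|\le L\|x-y\|$; $\beta$-cocoercive if $\langle x-y,u-v\rangle\ge\beta\|u-v\|^2$. (Lipschitz and cocoercive operators, and resolvents of monotone operators, are single-valued on their domains.) The (averaged) Davis–Yin splitting operator with stepsize $\alpha$ and averaging parameter $\lambda$ is $$T_{A,B,C,\alpha,\lambda}=I-\lambda J_{\alpha B}+\lambda J_{\alpha A}(2J_{\alpha B}-I-\alpha CJ_{\alpha B}),$$ which under the present assumptions is single-valued on its domain. A single-valued operator $T$ is $\rho$-contractive if $\|Tx-Ty\|\le\rho\|x-y\|$ for all $x,y\in\mathrm{dom}\,T$. *)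

theory Defs
  imports "HOL-Analysis.Analysis"
begin

text \<open>
  A multi-valued operator is identified with its graph: \<open>(x, u) \<in> A\<close> means \<open>u \<in> A x\<close>.
  The identity operator is \<^const>\<open>Id\<close>, the inverse is \<^const>\<open>converse\<close>, and \<^const>\<open>Domain\<close>
  is the domain. Neither full domain nor maximality is built in.
\<close>

type_synonym 'h operator = "('h \<times> 'h) set"

definition op_add :: "'h::plus operator \<Rightarrow> 'h operator \<Rightarrow> 'h operator"  (infixl "+\<^sub>o" 65) where
  "A +\<^sub>o B = {(x, u + v) | x u v. (x, u) \<in> A \<and> (x, v) \<in> B}"

definition op_diff :: "'h::minus operator \<Rightarrow> 'h operator \<Rightarrow> 'h operator"  (infixl "-\<^sub>o" 65) where
  "A -\<^sub>o B = {(x, u - v) | x u v. (x, u) \<in> A \<and> (x, v) \<in> B}"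

definition op_scale :: "real \<Rightarrow> 'h::scaleR operator \<Rightarrow> 'h operator"  (infixr "*\<^sub>o" 75) where
  "c *\<^sub>o A = {(x, c *\<^sub>R u) | x u. (x, u) \<in> A}"

text \<open>Operator composition applies \<open>B\<close> first, so the order is opposite to relation composition.\<close>

definition op_comp :: "'h operator \<Rightarrow> 'h operator \<Rightarrow> 'h operator"  (infixr "\<circ>\<^sub>o" 80) where
  "A \<circ>\<^sub>o B = B O A"

definition resolvent :: "'h::real_vector operator \<Rightarrow> 'h operator" where
  "resolvent A = (Id +\<^sub>o A)\<inverse>"

definition monotone_op :: "'h::real_inner operator \<Rightarrow> bool" where
  "monotone_op A \<longleftrightarrow>
    (\<forall>x y u v. (x, u) \<in> A \<longrightarrow> (y, v) \<in> A \<longrightarrow> (x - y) \<bullet> (u - v) \<ge> 0)"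

definition strongly_monotone_op :: "real \<Rightarrow> 'h::real_inner operator \<Rightarrow> bool" where
  "strongly_monotone_op \<mu> A \<longleftrightarrow>
    (\<forall>x y u v. (x, u) \<in> A \<longrightarrow> (y, v) \<in> A \<longrightarrow> (x - y) \<bullet> (u - v) \<ge> \<mu> * (norm (x - y))\<^sup>2)"

definition lipschitz_op :: "real \<Rightarrow> 'h::real_normed_vector operator \<Rightarrow> bool" where
  "lipschitz_op L A \<longleftrightarrow>
    (\<forall>x y u v. (x, u) \<in> A \<longrightarrow> (y, v) \<in> A \<longrightarrow> norm (u - v) \<le> L * norm (x - y))"

definition cocoercive_op :: "real \<Rightarrow> 'h::real_inner operator \<Rightarrow> bool" where
  "cocoercive_op \<beta> A \<longleftrightarrow>
    (\<forall>x y u v. (x, u) \<in> A \<longrightarrow> (y, v) \<in> A \<longrightarrow> (x - y) \<bullet> (u - v) \<ge> \<beta> * (norm (u - v))\<^sup>2)"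

text \<open>
  \<open>\<alpha>\<close> is the stepsize and \<open>\<theta>\<close> the averaging parameter, usually written lambda.
\<close>

definition davis_yin ::
  "'h::real_vector operator \<Rightarrow> 'h operator \<Rightarrow> 'h operator \<Rightarrow> real \<Rightarrow> real \<Rightarrow> 'h operator" where
  "davis_yin A B C \<alpha> \<theta> =
    (let JA = resolvent (\<alpha> *\<^sub>o A); JB = resolvent (\<alpha> *\<^sub>o B)
     in Id -\<^sub>o \<theta> *\<^sub>o JB +\<^sub>o \<theta> *\<^sub>o (JA \<circ>\<^sub>o (2 *\<^sub>o JB -\<^sub>o Id -\<^sub>o \<alpha> *\<^sub>o (C \<circ>\<^sub>o JB))))"

text \<open>
  Contractivity is a property of single-valued operators only, so single-valuedness
  (on the possibly proper domain) is part of the definition.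
\<close>

definition contractive_op :: "real \<Rightarrow> 'h::real_normed_vector operator \<Rightarrow> bool" where
  "contractive_op \<rho> T \<longleftrightarrow> single_valued T \<and>
    (\<forall>x y u v. (x, u) \<in> T \<longrightarrow> (y, v) \<in> T \<longrightarrow> norm (u - v) \<le> \<rho> * norm (x - y))"

end

theory Submission
  imports Defs
begin

text \<open>
  The difference of two points of the graph of the splitting operator is
  \<open>z \<mapsto> z - \<theta> \<alpha> (a + b + c)\<close> with \<open>z = x\<^sub>B + \<alpha> b\<close> and
  \<open>x\<^sub>B - x\<^sub>A = \<alpha> (a + b + c)\<close>. Expanding its norm and completing the square bounds the decrease
  of the squared norm from below by \<open>2 \<theta> \<alpha> (\<langle>x\<^sub>B, b\<rangle> + M \<parallel>x\<^sub>B\<parallel>\<^sup>2)\<close>, where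
  \<open>M = \<mu> (1 - \<alpha> / (2 \<beta> (2 - \<theta>)))\<close>; if \<open>B\<close> is Lipschitz, this controls \<open>\<parallel>z\<parallel>\<^sup>2\<close>.

  If \<open>A\<close> is Lipschitz, we use duality. The conditions involve two points of each graph only,
  so the differences can be interpolated by linear operators that satisfy the same conditions
  together with their adjoints. The adjoint of \<open>T\<close> for linear \<open>(A, B, C)\<close> is \<open>T\<close> for
  \<open>(B*, A*, C*)\<close>, to which the first estimate applies.
\<close>

section \<open>Norm estimate when \<open>B\<close> is Lipschitz\<close>

text \<open>The two entries of the minimum are the extreme configurations with
  \<open>norm b = L * norm x\<close>: \<open>b\<close> parallel to \<open>x\<close> gives the first,
  \<open>b\<close> orthogonal to \<open>x\<close> the second.\<close>

lemma lipschitz_monotone_norm_bound: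
  fixes x b :: "'h::real_inner"
  assumes "0 < \<alpha>" "0 < L" "0 \<le> M" and mono: "0 \<le> x \<bullet> b" and lip: "norm b \<le> L * norm x"
  shows "min ((L + M) / (1 + \<alpha> * L)\<^sup>2) (M / (1 + \<alpha>\<^sup>2 * L\<^sup>2)) * (norm (x + \<alpha> *\<^sub>R b))\<^sup>2
           \<le> x \<bullet> b + M * (norm x)\<^sup>2"
proof -
  define m where "m = min ((L + M) / (1 + \<alpha> * L)\<^sup>2) (M / (1 + \<alpha>\<^sup>2 * L\<^sup>2))"
  define X where "X = (norm x)\<^sup>2"
  define S where "S = x \<bullet> b"
  have m0: "0 \<le> m"
    using assms by (simp add: m_def)
  have pos: "0 < (1 + \<alpha> * L)\<^sup>2" "0 < 1 + \<alpha>\<^sup>2 * L\<^sup>2"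
    using mult_pos_pos[OF assms(1,2)] by (auto intro: add_pos_nonneg)
  have "m \<le> (L + M) / (1 + \<alpha> * L)\<^sup>2" "m \<le> M / (1 + \<alpha>\<^sup>2 * L\<^sup>2)"
    by (simp_all add: m_def)
  then have m1: "m * (1 + \<alpha> * L)\<^sup>2 \<le> L + M" and m2: "m * (1 + \<alpha>\<^sup>2 * L\<^sup>2) \<le> M"
    using pos by (simp_all add: pos_le_divide_eq)
  have X0: "0 \<le> X" by (simp add: X_def)
  have "S \<le> norm x * norm b"
    unfolding S_def by (rule norm_cauchy_schwarz)
  also have "\<dots> \<le> norm x * (L * norm x)"
    by (intro mult_left_mono lip) simp
  finally have SL: "S \<le> L * X" by (simp add: X_def power2_eq_square mult_ac)
  have Nb: "(norm b)\<^sup>2 \<le> L\<^sup>2 * X"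
    using power_mono[OF lip, of 2] by (simp add: X_def power_mult_distrib)
  have "(norm (x + \<alpha> *\<^sub>R b))\<^sup>2 = X + 2 * \<alpha> * S + \<alpha>\<^sup>2 * (norm b)\<^sup>2"
    unfolding X_def S_def power2_norm_eq_inner
    by (simp add: inner_simps inner_commute power2_eq_square algebra_simps)
  also have "\<dots> \<le> X + 2 * \<alpha> * S + \<alpha>\<^sup>2 * (L\<^sup>2 * X)"
    using Nb by (simp add: mult_left_mono)
  finally have "m * (norm (x + \<alpha> *\<^sub>R b))\<^sup>2 \<le> m * (X + 2 * \<alpha> * S + \<alpha>\<^sup>2 * (L\<^sup>2 * X))"
    using m0 by (rule mult_left_mono)
  also have "\<dots> \<le> S + M * X"
  proof -
    \<comment> \<open>the inequality is affine in \<open>S\<close> and holds at both ends of \<open>0 \<le> S \<le> L X\<close>\<close>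
    have "0 \<le> (M - m * (1 + \<alpha>\<^sup>2 * L\<^sup>2)) * (L * X - S) + (L + M - m * (1 + \<alpha> * L)\<^sup>2) * S"
      using m1 m2 SL mono by (intro add_nonneg_nonneg mult_nonneg_nonneg) (auto simp: S_def)
    also have "\<dots> = L * (S + M * X - m * (X + 2 * \<alpha> * S + \<alpha>\<^sup>2 * (L\<^sup>2 * X)))"
      by (simp add: power2_eq_square algebra_simps)
    finally show ?thesis
      using \<open>0 < L\<close> by (simp add: zero_le_mult_iff)
  qed
  finally show ?thesis
    by (simp add: m_def X_def S_def)
qed

lemma davis_yin_parameters:
  fixes \<alpha> \<beta> \<theta> :: real
  assumes "0 < \<alpha>" "\<alpha> < 4 * \<beta>" "\<theta> < 2 - \<alpha> / (2 * \<beta>)"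
  shows "0 < \<beta>" "0 < 2 - \<theta>" "0 \<le> 1 - \<alpha> / (2 * \<beta> * (2 - \<theta>))"
proof -
  show \<beta>: "0 < \<beta>" using assms by linarith
  have less: "\<alpha> / (2 * \<beta>) < 2 - \<theta>" and "0 < \<alpha> / (2 * \<beta>)"
    using assms \<beta> by auto
  then show \<theta>: "0 < 2 - \<theta>" by linarith
  show "0 \<le> 1 - \<alpha> / (2 * \<beta> * (2 - \<theta>))"
    using less \<theta> \<beta> by (simp add: field_simps)
qed

text \<open>Completing the square leaves a multiple of \<open>c \<bullet> c\<close>. Cocoercivity
  pays for it with the fraction \<open>\<alpha> / (2 * \<beta> * (2 - \<theta>))\<close> of
  \<open>xB \<bullet> c\<close>; strong monotonicity uses the rest.\<close>

lemma davis_yin_norm_decrease: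
  fixes xA xB a b c :: "'h::real_inner"
  assumes "0 < \<alpha>" "\<alpha> < 4 * \<beta>" "0 < \<theta>" "\<theta> < 2 - \<alpha> / (2 * \<beta>)"
    and A: "0 \<le> xA \<bullet> a"
    and C: "\<beta> * (norm c)\<^sup>2 \<le> xB \<bullet> c" "\<mu> * (norm xB)\<^sup>2 \<le> xB \<bullet> c"
    and step: "xB - xA = \<alpha> *\<^sub>R (a + b + c)"
  shows "(norm (xB + \<alpha> *\<^sub>R b - \<theta> *\<^sub>R xB + \<theta> *\<^sub>R xA))\<^sup>2 \<le> (norm (xB + \<alpha> *\<^sub>R b))\<^sup>2
           - 2 * \<theta> * \<alpha> * (xB \<bullet> b + \<mu> * (1 - \<alpha> / (2 * \<beta> * (2 - \<theta>))) * (norm xB)\<^sup>2)"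
proof -
  define d where "d = a + b + c"
  define z where "z = xB + \<alpha> *\<^sub>R b"
  define \<kappa> where "\<kappa> = 1 - \<alpha> / (2 * \<beta> * (2 - \<theta>))"
  note params = davis_yin_parameters[OF assms(1,2,4)]
  have "0 < \<beta>" and \<theta>2: "0 < 2 - \<theta>" and \<kappa>0: "0 \<le> \<kappa>"
    using params by (simp_all add: \<kappa>_def)
  have b: "b = d - a - c" by (simp add: d_def)
  have xA: "xA = xB - \<alpha> *\<^sub>R d"
    using step by (simp add: d_def algebra_simps)
  have t: "xB + \<alpha> *\<^sub>R b - \<theta> *\<^sub>R xB + \<theta> *\<^sub>R xA = z - (\<theta> * \<alpha>) *\<^sub>R d"
    by (simp add: xA z_def algebra_simps)
  \<comment> \<open>For fixed \<open>c\<close>, the left side of \<open>sq\<close> is largest at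
    \<open>d = c / (2 - \<theta>)\<close>, where this square vanishes.\<close>
  have "0 \<le> (norm ((2 - \<theta>) *\<^sub>R d - c))\<^sup>2" by simp
  also have "\<dots> = (2 - \<theta>) * ((2 - \<theta>) * (d \<bullet> d) + c \<bullet> c / (2 - \<theta>) - 2 * (c \<bullet> d))"
    using \<theta>2 by (simp add: power2_norm_eq_inner inner_simps inner_commute field_simps)
  finally have sq: "2 * (c \<bullet> d) - (2 - \<theta>) * (d \<bullet> d) \<le> c \<bullet> c / (2 - \<theta>)"
    using \<theta>2 by (simp add: zero_le_mult_iff)
  \<comment> \<open>Since \<open>a + b = d - c\<close> and \<open>xA = xB - \<alpha> d\<close>, the
    inner product \<open>z \<bullet> d\<close> is the sum of the three operator terms plus
    \<open>\<alpha> * (d \<bullet> (d - c))\<close>.\<close>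
  have "(norm (z - (\<theta> * \<alpha>) *\<^sub>R d))\<^sup>2 = (norm z)\<^sup>2
      - 2 * \<theta> * \<alpha> * (xA \<bullet> a + xB \<bullet> b + xB \<bullet> c)
      + \<theta> * \<alpha>\<^sup>2 * (2 * (c \<bullet> d) - (2 - \<theta>) * (d \<bullet> d))"
    unfolding z_def xA b power2_norm_eq_inner
    by (simp add: inner_simps inner_commute power2_eq_square algebra_simps)
  also have "\<dots> \<le> (norm z)\<^sup>2 - 2 * \<theta> * \<alpha> * (xA \<bullet> a + xB \<bullet> b + xB \<bullet> c)
      + \<theta> * \<alpha>\<^sup>2 * (c \<bullet> c / (2 - \<theta>))"
    using sq assms by (intro add_left_mono mult_left_mono) auto
  also have "\<dots> = (norm z)\<^sup>2
      - 2 * \<theta> * \<alpha> * (xA \<bullet> a + xB \<bullet> b + (xB \<bullet> c - \<alpha> / (2 * (2 - \<theta>)) * (c \<bullet> c)))"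
    using \<theta>2 by (simp add: power2_eq_square field_simps)
  also have "\<dots> \<le> (norm z)\<^sup>2 - 2 * \<theta> * \<alpha> * (xB \<bullet> b + \<mu> * \<kappa> * (norm xB)\<^sup>2)"
  proof -
    have "\<mu> * \<kappa> * (norm xB)\<^sup>2 \<le> \<kappa> * (xB \<bullet> c)"
      using mult_left_mono[OF C(2) \<kappa>0] by (simp add: mult_ac)
    also have "\<dots> = xB \<bullet> c - \<alpha> / (2 * (2 - \<theta>)) * (xB \<bullet> c / \<beta>)"
      by (simp add: \<kappa>_def algebra_simps)
    also have "\<dots> \<le> xB \<bullet> c - \<alpha> / (2 * (2 - \<theta>)) * (c \<bullet> c)"
    proof -
      have "c \<bullet> c \<le> xB \<bullet> c / \<beta>"
        using C(1) \<open>0 < \<beta>\<close> by (simp add: power2_norm_eq_inner field_simps)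
      then show ?thesis
        using \<theta>2 \<open>0 < \<alpha>\<close> by (intro diff_left_mono mult_left_mono) auto
    qed
    finally show ?thesis
      using A assms by (intro diff_left_mono mult_left_mono) auto
  qed
  finally show ?thesis
    unfolding t by (simp add: z_def \<kappa>_def)
qed

definition davis_yin_rate :: "real \<Rightarrow> real \<Rightarrow> real \<Rightarrow> real \<Rightarrow> real \<Rightarrow> real" where
  "davis_yin_rate \<alpha> \<beta> \<theta> \<mu> L = sqrt (1 - 2 * \<theta> * \<alpha> * min
     ((L + \<mu> * (1 - \<alpha> / (2 * \<beta> * (2 - \<theta>)))) / (1 + \<alpha> * L)\<^sup>2)
     (\<mu> * (1 - \<alpha> / (2 * \<beta> * (2 - \<theta>))) / (1 + \<alpha>\<^sup>2 * L\<^sup>2)))"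

lemma davis_yin_norm_bound_right:
  fixes xA xB a b c :: "'h::real_inner"
  assumes "0 < \<alpha>" "\<alpha> < 4 * \<beta>" "0 < \<theta>" "\<theta> < 2 - \<alpha> / (2 * \<beta>)" "0 < L" "0 < \<mu>"
    and "0 \<le> xA \<bullet> a"
    and "0 \<le> xB \<bullet> b" "norm b \<le> L * norm xB"
    and "\<beta> * (norm c)\<^sup>2 \<le> xB \<bullet> c" "\<mu> * (norm xB)\<^sup>2 \<le> xB \<bullet> c"
    and "xB - xA = \<alpha> *\<^sub>R (a + b + c)"
  shows "norm (xB + \<alpha> *\<^sub>R b - \<theta> *\<^sub>R xB + \<theta> *\<^sub>R xA)
           \<le> davis_yin_rate \<alpha> \<beta> \<theta> \<mu> L * norm (xB + \<alpha> *\<^sub>R b)"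
proof -
  define z where "z = xB + \<alpha> *\<^sub>R b"
  define M where "M = \<mu> * (1 - \<alpha> / (2 * \<beta> * (2 - \<theta>)))"
  define m where "m = min ((L + M) / (1 + \<alpha> * L)\<^sup>2) (M / (1 + \<alpha>\<^sup>2 * L\<^sup>2))"
  have "0 \<le> M"
    using davis_yin_parameters(3)[OF assms(1,2,4)] \<open>0 < \<mu>\<close> by (simp add: M_def)
  then have "m * (norm z)\<^sup>2 \<le> xB \<bullet> b + M * (norm xB)\<^sup>2"
    unfolding m_def z_def using assms by (intro lipschitz_monotone_norm_bound) auto
  then have "2 * \<theta> * \<alpha> * (m * (norm z)\<^sup>2) \<le> 2 * \<theta> * \<alpha> * (xB \<bullet> b + M * (norm xB)\<^sup>2)"
    using assms by (intro mult_left_mono) auto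
  moreover have "(norm (z - \<theta> *\<^sub>R xB + \<theta> *\<^sub>R xA))\<^sup>2
      \<le> (norm z)\<^sup>2 - 2 * \<theta> * \<alpha> * (xB \<bullet> b + M * (norm xB)\<^sup>2)"
    unfolding z_def M_def by (rule davis_yin_norm_decrease) (use assms in auto)
  ultimately have "(norm (z - \<theta> *\<^sub>R xB + \<theta> *\<^sub>R xA))\<^sup>2 \<le> (1 - 2 * \<theta> * \<alpha> * m) * (norm z)\<^sup>2"
    by (simp add: algebra_simps)
  \<comment> \<open>\<open>sqrt\<close> is total and multiplicative on all reals, so the root splits
    without settling the sign of \<open>1 - 2 * \<theta> * \<alpha> * m\<close>.\<close>
  from real_le_rsqrt[OF this] show ?thesis
    by (simp add: z_def davis_yin_rate_def M_def m_def real_sqrt_mult)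
qed

section \<open>Interpolation by linear maps with adjoints\<close>

text \<open>
  On the span of \<open>e\<close> and \<open>f\<close>, this is multiplication by the complex number \<open>s + i \<tau>\<close>; on the
  orthogonal complement it is multiplication by \<open>k\<close>. The adjoint is obtained from \<open>\<tau> \<mapsto> -\<tau>\<close>.
\<close>

definition plane_map :: "real \<Rightarrow> real \<Rightarrow> real \<Rightarrow> 'h \<Rightarrow> 'h \<Rightarrow> 'h \<Rightarrow> 'h::real_inner" where
  "plane_map k s \<tau> e f x = k *\<^sub>R x + (s - k) *\<^sub>R ((e \<bullet> x) *\<^sub>R e + (f \<bullet> x) *\<^sub>R f)
     + \<tau> *\<^sub>R ((e \<bullet> x) *\<^sub>R f - (f \<bullet> x) *\<^sub>R e)"

lemma plane_map_adjoint: "plane_map k s \<tau> e f x \<bullet> y = x \<bullet> plane_map k s (- \<tau>) e f y"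
  by (simp add: plane_map_def inner_simps inner_commute algebra_simps)

text \<open>The map preserves the span of \<open>e\<close> and \<open>f\<close> and its orthogonal
  complement; \<open>v\<close> and \<open>u\<close> are the squared norms of the components of
  \<open>x\<close> there. The case \<open>f = 0\<close> is a one-dimensional span without
  rotation.\<close>

lemma plane_map_forms:
  fixes e f x :: "'h::real_inner"
  assumes "e \<bullet> e = 1" "e \<bullet> f = 0" "f \<bullet> f = 1 \<or> f = 0 \<and> \<tau> = 0"
  obtains u v where "0 \<le> u" "0 \<le> v" "x \<bullet> x = u + v"
    "x \<bullet> plane_map k s \<tau> e f x = u * k + v * s"
    "plane_map k s \<tau> e f x \<bullet> plane_map k s \<tau> e f x = u * k\<^sup>2 + v * (s\<^sup>2 + \<tau>\<^sup>2)"
proof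
  define v where "v = (e \<bullet> x)\<^sup>2 + (f \<bullet> x)\<^sup>2"
  define y where "y = x - (e \<bullet> x) *\<^sub>R e - (f \<bullet> x) *\<^sub>R f"
  have fe: "f \<bullet> e = 0" using assms(2) by (simp add: inner_commute)
  have "y \<bullet> y = x \<bullet> x - v"
    using assms(3)
    by (auto simp: y_def v_def inner_simps assms(1,2) fe inner_commute[of x e]
        inner_commute[of x f] power2_eq_square
        algebra_simps)
  then show "0 \<le> x \<bullet> x - v"
    using inner_ge_zero[of y] by simp
  show "0 \<le> v" by (simp add: v_def)
  show "x \<bullet> x = x \<bullet> x - v + v" by simp
  show "x \<bullet> plane_map k s \<tau> e f x = (x \<bullet> x - v) * k + v * s"
    by (simp add: plane_map_def v_def inner_simps inner_commute[of x e]
        inner_commute[of x f] power2_eq_square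
        algebra_simps)
  show "plane_map k s \<tau> e f x \<bullet> plane_map k s \<tau> e f x
      = (x \<bullet> x - v) * k\<^sup>2 + v * (s\<^sup>2 + \<tau>\<^sup>2)"
    using assms(3)
    by (auto simp: plane_map_def v_def inner_simps assms(1,2) fe inner_commute[of x e] inner_commute[of x f]
        power2_eq_square algebra_simps)
qed

text \<open>
  The three forms of \<open>J'\<close> at \<open>x\<close> are a conic combination of those of the pairs \<open>(1, k)\<close> and
  \<open>(p, q)\<close>. Hence a condition that is linear in the forms and holds for these two pairs
  holds for all pairs \<open>(x, J' x)\<close>.
\<close>

lemma adjoint_interpolation:
  fixes p q :: "'h::real_inner" and k :: real
  assumes "p = 0 \<Longrightarrow> q = 0"
  obtains J J' :: "'h \<Rightarrow> 'h" where
    "J p = q" "\<forall>x y. J x \<bullet> y = x \<bullet> J' y"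
    "\<forall>x. \<exists>u\<ge>0. \<exists>v\<ge>0. x \<bullet> x = u + v * (p \<bullet> p) \<and> x \<bullet> J' x = u * k + v * (p \<bullet> q)
       \<and> J' x \<bullet> J' x = u * k\<^sup>2 + v * (q \<bullet> q)"
proof (cases "p = 0")
  case True
  show ?thesis
  proof (rule that[of "\<lambda>x. k *\<^sub>R x" "\<lambda>x. k *\<^sub>R x"])
    show "k *\<^sub>R p = q" using True assms by simp
    show "\<forall>x. \<exists>u\<ge>0. \<exists>v\<ge>0. x \<bullet> x = u + v * (p \<bullet> p) \<and> x \<bullet> k *\<^sub>R x = u * k + v * (p \<bullet> q)
       \<and> k *\<^sub>R x \<bullet> k *\<^sub>R x = u * k\<^sup>2 + v * (q \<bullet> q)"
    proof
      show "\<exists>u\<ge>0. \<exists>v\<ge>0. x \<bullet> x = u + v * (p \<bullet> p) \<and> x \<bullet> k *\<^sub>R x = u * k + v * (p \<bullet> q)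
         \<and> k *\<^sub>R x \<bullet> k *\<^sub>R x = u * k\<^sup>2 + v * (q \<bullet> q)" for x
        by (rule exI[of _ "x \<bullet> x"], simp, rule exI[of _ 0]) (simp add: power2_eq_square)
    qed
  qed simp
next
  case False
  \<comment> \<open>Split \<open>q = s p + r\<close> with \<open>r\<close> orthogonal to
    \<open>p\<close>. In the plane of \<open>p\<close> and \<open>r\<close>, multiplication by
    \<open>s + i \<tau>\<close> takes \<open>p\<close> to \<open>q\<close>.\<close>
  define s where "s = p \<bullet> q / (p \<bullet> p)"
  define r where "r = q - s *\<^sub>R p"
  define \<tau> where "\<tau> = norm r / norm p"
  define e where "e = sgn p"
  define f where "f = sgn r"
  have p: "p = norm p *\<^sub>R e" and r: "r = norm r *\<^sub>R f"
    by (cases "p = 0"; cases "r = 0"; simp add: e_def f_def sgn_div_norm)+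
  have np: "norm p > 0" "p \<bullet> p > 0" using False by auto
  have pr: "p \<bullet> r = 0"
    using False by (simp add: r_def s_def inner_simps)
  have ee: "e \<bullet> e = 1"
    using False by (simp add: e_def sgn_div_norm dot_square_norm power2_eq_square)
  have ef: "e \<bullet> f = 0"
    using pr by (simp add: e_def f_def sgn_div_norm)
  have ff: "f \<bullet> f = 1 \<or> f = 0 \<and> \<tau> = 0"
    by (cases "r = 0") (auto simp: f_def \<tau>_def sgn_div_norm dot_square_norm power2_eq_square)
  have q: "q = s *\<^sub>R p + r" by (simp add: r_def)
  have ps: "p \<bullet> q = s * (p \<bullet> p)" using np by (simp add: s_def)
  have "q \<bullet> q = s\<^sup>2 * (p \<bullet> p) + r \<bullet> r"
    unfolding q using pr by (simp add: inner_simps inner_commute power2_eq_square)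
  also have "r \<bullet> r = \<tau>\<^sup>2 * (p \<bullet> p)"
    using np by (simp add: \<tau>_def dot_square_norm power_divide)
  finally have qq: "q \<bullet> q = (s\<^sup>2 + \<tau>\<^sup>2) * (p \<bullet> p)" by (simp add: algebra_simps)
  show ?thesis
  proof (rule that[of "plane_map k s \<tau> e f" "plane_map k s (- \<tau>) e f"])
    have ep: "e \<bullet> p = norm p" and fp: "f \<bullet> p = 0"
      using ee ef by (subst p, simp add: inner_commute)+
    have "plane_map k s \<tau> e f p = k *\<^sub>R p + (s - k) *\<^sub>R (norm p *\<^sub>R e) + (\<tau> * norm p) *\<^sub>R f"
      by (simp add: plane_map_def ep fp)
    also have "\<dots> = s *\<^sub>R p + r"
      using np p[symmetric] r[symmetric] by (simp add: \<tau>_def algebra_simps)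
    finally show "plane_map k s \<tau> e f p = q" by (simp add: q)
    show "\<forall>x y. plane_map k s \<tau> e f x \<bullet> y = x \<bullet> plane_map k s (- \<tau>) e f y"
      by (simp add: plane_map_adjoint)
    have "\<exists>u\<ge>0. \<exists>v\<ge>0. x \<bullet> x = u + v * (p \<bullet> p)
        \<and> x \<bullet> plane_map k s (- \<tau>) e f x = u * k + v * (p \<bullet> q)
        \<and> plane_map k s (- \<tau>) e f x \<bullet> plane_map k s (- \<tau>) e f x = u * k\<^sup>2 + v * (q \<bullet> q)" for x
    proof -
      \<comment> \<open>The forms see only the square of \<open>\<tau>\<close>, so the adjoint, with
        \<open>- \<tau>\<close>, has the same forms as the interpolant.\<close>
      from ff have "f \<bullet> f = 1 \<or> f = 0 \<and> - \<tau> = 0" by simp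
      from plane_map_forms[OF ee ef this, of x k s] obtain u v where uv: "0 \<le> u" "0 \<le> v"
        "x \<bullet> x = u + v" "x \<bullet> plane_map k s (- \<tau>) e f x = u * k + v * s"
        "plane_map k s (- \<tau>) e f x \<bullet> plane_map k s (- \<tau>) e f x = u * k\<^sup>2 + v * (s\<^sup>2 + (- \<tau>)\<^sup>2)"
        by blast
      show ?thesis
        \<comment> \<open>Here \<open>v\<close> refers to the unit vector \<open>e\<close>; the
          division rescales it to \<open>p\<close>.\<close>
        by (rule exI[of _ u], simp add: uv, rule exI[of _ "v / (p \<bullet> p)"])
          (use uv np in \<open>simp add: ps qq\<close>)
    qed
    then show "\<forall>x. \<exists>u\<ge>0. \<exists>v\<ge>0. x \<bullet> x = u + v * (p \<bullet> p)
        \<and> x \<bullet> plane_map k s (- \<tau>) e f x = u * k + v * (p \<bullet> q)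
        \<and> plane_map k s (- \<tau>) e f x \<bullet> plane_map k s (- \<tau>) e f x = u * k\<^sup>2 + v * (q \<bullet> q)"
      by blast
  qed
qed

section \<open>Duality when \<open>A\<close> is Lipschitz\<close>

lemma davis_yin_norm_bound_left:
  fixes xA xB a b c :: "'h::real_inner"
  assumes params: "0 < \<alpha>" "\<alpha> < 4 * \<beta>" "0 < \<theta>" "\<theta> < 2 - \<alpha> / (2 * \<beta>)" "0 < L" "0 < \<mu>"
      "\<mu> \<le> 1 / \<beta>"
    and A: "0 \<le> xA \<bullet> a" "norm a \<le> L * norm xA"
    and B: "0 \<le> xB \<bullet> b"
    and C: "\<beta> * (norm c)\<^sup>2 \<le> xB \<bullet> c" "\<mu> * (norm xB)\<^sup>2 \<le> xB \<bullet> c"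
    and step: "xB - xA = \<alpha> *\<^sub>R (a + b + c)"
  shows "norm (xB + \<alpha> *\<^sub>R b - \<theta> *\<^sub>R xB + \<theta> *\<^sub>R xA)
           \<le> davis_yin_rate \<alpha> \<beta> \<theta> \<mu> L * norm (xB + \<alpha> *\<^sub>R b)"
proof -
  define z where "z = xB + \<alpha> *\<^sub>R b"
  define w where "w = xA + \<alpha> *\<^sub>R a"
  define t where "t = z - \<theta> *\<^sub>R xB + \<theta> *\<^sub>R xA"
  have w: "w = 2 *\<^sub>R xB - z - \<alpha> *\<^sub>R c"
    unfolding w_def z_def scaleR_2 using step by (simp add: algebra_simps)
  have "0 < \<beta>" using params by linarith
  have "\<beta> * \<mu> \<le> 1" using params \<open>0 < \<beta>\<close> by (simp add: field_simps)
  \<comment> \<open>The resolvents, not \<open>A\<close> and \<open>B\<close>, get interpolated.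
    Monotonicity becomes firm nonexpansiveness, and the Lipschitz bound becomes \<open>AL\<close>;
    both are linear in the forms.\<close>
  have resolvent_form: "0 \<le> (x + \<alpha> *\<^sub>R y) \<bullet> x - x \<bullet> x" if "0 \<le> x \<bullet> y" for x y :: 'h
    using that params by (simp add: inner_simps inner_commute)
  have resolvent_zero: "x = 0" if "0 \<le> x \<bullet> y" "x + \<alpha> *\<^sub>R y = 0" for x y :: 'h
    using resolvent_form[OF that(1)] that(2) inner_ge_zero[of x] by simp
  have Bq: "0 \<le> z \<bullet> xB - xB \<bullet> xB"
    unfolding z_def using B by (rule resolvent_form)
  have Aq: "0 \<le> w \<bullet> xA - xA \<bullet> xA"
    unfolding w_def using A(1) by (rule resolvent_form)
  have "\<alpha>\<^sup>2 * (norm a)\<^sup>2 \<le> \<alpha>\<^sup>2 * (L * norm xA)\<^sup>2"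
    using A(2) by (intro mult_left_mono power_mono) auto
  then have AL: "w \<bullet> w - 2 * (w \<bullet> xA) + xA \<bullet> xA \<le> \<alpha>\<^sup>2 * L\<^sup>2 * (xA \<bullet> xA)"
    unfolding power_mult_distrib power2_norm_eq_inner
    by (simp add: w_def inner_simps inner_commute power2_eq_square algebra_simps)
  have z0: "z = 0 \<Longrightarrow> xB = 0" and w0: "w = 0 \<Longrightarrow> xA = 0"
    using resolvent_zero B A(1) by (auto simp: z_def w_def)
  have c0: "xB = 0 \<Longrightarrow> c = 0"
    using C(1) \<open>0 < \<beta>\<close> by (simp add: mult_le_0_iff)
  \<comment> \<open>the complement values \<open>1\<close>, \<open>1\<close> and \<open>\<mu>\<close> correspond to \<open>B = 0\<close>, \<open>A = 0\<close> and \<open>C = \<mu> I\<close>; the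
    latter is \<open>\<beta>\<close>-cocoercive because of \<open>\<mu> \<le> 1 / \<beta>\<close>\<close>
  obtain JB JB' where JB: "JB z = xB" "\<forall>x y. JB x \<bullet> y = x \<bullet> JB' y"
    "\<forall>x. \<exists>u\<ge>0. \<exists>v\<ge>0. x \<bullet> x = u + v * (z \<bullet> z) \<and> x \<bullet> JB' x = u * 1 + v * (z \<bullet> xB)
       \<and> JB' x \<bullet> JB' x = u * 1\<^sup>2 + v * (xB \<bullet> xB)"
    by (rule adjoint_interpolation[of z xB 1, OF z0])
  obtain JA JA' where JA: "JA w = xA" "\<forall>x y. JA x \<bullet> y = x \<bullet> JA' y"
    "\<forall>x. \<exists>u\<ge>0. \<exists>v\<ge>0. x \<bullet> x = u + v * (w \<bullet> w) \<and> x \<bullet> JA' x = u * 1 + v * (w \<bullet> xA)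
       \<and> JA' x \<bullet> JA' x = u * 1\<^sup>2 + v * (xA \<bullet> xA)"
    by (rule adjoint_interpolation[of w xA 1, OF w0])
  obtain K K' where K: "K xB = c" "\<forall>x y. K x \<bullet> y = x \<bullet> K' y"
    "\<forall>x. \<exists>u\<ge>0. \<exists>v\<ge>0. x \<bullet> x = u + v * (xB \<bullet> xB) \<and> x \<bullet> K' x = u * \<mu> + v * (xB \<bullet> c)
       \<and> K' x \<bullet> K' x = u * \<mu>\<^sup>2 + v * (c \<bullet> c)"
    by (rule adjoint_interpolation[of xB c \<mu>, OF c0])
  \<comment> \<open>The complement pair \<open>(1, 1)\<close> contributes \<open>1 - 1 = 0\<close>,
    so only the \<open>v\<close> term remains.\<close>
  have JB'_mono: "0 \<le> JB' x \<bullet> (x - JB' x)" for x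
  proof -
    from spec[OF JB(3), of x] obtain u v where uv: "0 \<le> v" "x \<bullet> JB' x = u + v * (z \<bullet> xB)"
      "JB' x \<bullet> JB' x = u + v * (xB \<bullet> xB)" by auto
    have "0 \<le> v * (z \<bullet> xB - xB \<bullet> xB)" using uv(1) Bq by simp
    then show ?thesis using uv by (simp add: inner_simps inner_commute algebra_simps)
  qed
  have JA'_mono: "0 \<le> JA' x \<bullet> (x - JA' x)"
    and JA'_lip: "norm (x - JA' x) \<le> \<alpha> * L * norm (JA' x)"
    for x
  proof -
    from spec[OF JA(3), of x] obtain u v where uv: "0 \<le> u" "0 \<le> v" "x \<bullet> x = u + v * (w \<bullet> w)"
      "x \<bullet> JA' x = u + v * (w \<bullet> xA)" "JA' x \<bullet> JA' x = u + v * (xA \<bullet> xA)" by auto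
    have "0 \<le> v * (w \<bullet> xA - xA \<bullet> xA)" using uv(2) Aq by simp
    then show "0 \<le> JA' x \<bullet> (x - JA' x)"
      using uv by (simp add: inner_simps inner_commute algebra_simps)
    have "(norm (x - JA' x))\<^sup>2 = v * (w \<bullet> w - 2 * (w \<bullet> xA) + xA \<bullet> xA)"
      using uv by (simp add: power2_norm_eq_inner inner_simps inner_commute algebra_simps)
    also have "\<dots> \<le> v * (\<alpha>\<^sup>2 * L\<^sup>2 * (xA \<bullet> xA))"
      using AL uv(2) by (rule mult_left_mono)
    also have "\<dots> \<le> \<alpha>\<^sup>2 * L\<^sup>2 * (u + v * (xA \<bullet> xA))"
      using uv(1) by (simp add: algebra_simps)
    also have "\<dots> = (\<alpha> * L * norm (JA' x))\<^sup>2"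
      by (simp add: power_mult_distrib power2_norm_eq_inner uv)
    finally show "norm (x - JA' x) \<le> \<alpha> * L * norm (JA' x)"
      by (rule power2_le_imp_le) (use params in auto)
  qed
  have K'_coco: "\<beta> * (norm (K' x))\<^sup>2 \<le> x \<bullet> K' x" and K'_strong: "\<mu> * (norm x)\<^sup>2 \<le> x \<bullet> K' x" for x
  proof -
    from spec[OF K(3), of x] obtain u v where uv: "0 \<le> u" "0 \<le> v" "x \<bullet> x = u + v * (xB \<bullet> xB)"
      "x \<bullet> K' x = u * \<mu> + v * (xB \<bullet> c)" "K' x \<bullet> K' x = u * \<mu>\<^sup>2 + v * (c \<bullet> c)" by auto
    have "u * \<mu> * (\<beta> * \<mu>) \<le> u * \<mu> * 1"
      using \<open>\<beta> * \<mu> \<le> 1\<close> uv(1) params by (intro mult_left_mono) auto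
    moreover have "v * (\<beta> * (c \<bullet> c)) \<le> v * (xB \<bullet> c)"
      using C(1) uv(2) by (intro mult_left_mono) (auto simp: power2_norm_eq_inner)
    ultimately show "\<beta> * (norm (K' x))\<^sup>2 \<le> x \<bullet> K' x"
      unfolding power2_norm_eq_inner uv by (simp add: power2_eq_square algebra_simps)
    have "v * (\<mu> * (xB \<bullet> xB)) \<le> v * (xB \<bullet> c)"
      using C(2) uv(2) by (intro mult_left_mono) (auto simp: power2_norm_eq_inner)
    then show "\<mu> * (norm x)\<^sup>2 \<le> x \<bullet> K' x"
      by (simp add: power2_norm_eq_inner uv algebra_simps)
  qed
  define T' where "T' y = y - \<theta> *\<^sub>R JA' y + \<theta> *\<^sub>R JB' (2 *\<^sub>R JA' y - y - \<alpha> *\<^sub>R K' (JA' y))" for y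
  have T'_bound: "norm (T' y) \<le> davis_yin_rate \<alpha> \<beta> \<theta> \<mu> L * norm y" for y
  proof -
    define x1 where "x1 = JA' y"
    \<comment> \<open>\<open>b1\<close> and \<open>a1\<close> recover operator values from the
      resolvents; the Lipschitz one now sits in the second slot.\<close>
    define b1 where "b1 = (1 / \<alpha>) *\<^sub>R (y - x1)"
    define c1 where "c1 = K' x1"
    define w1 where "w1 = 2 *\<^sub>R x1 - y - \<alpha> *\<^sub>R c1"
    define x2 where "x2 = JB' w1"
    define a1 where "a1 = (1 / \<alpha>) *\<^sub>R (w1 - x2)"
    have y: "x1 + \<alpha> *\<^sub>R b1 = y" using params by (simp add: b1_def)
    have "norm (x1 + \<alpha> *\<^sub>R b1 - \<theta> *\<^sub>R x1 + \<theta> *\<^sub>R x2)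
        \<le> davis_yin_rate \<alpha> \<beta> \<theta> \<mu> L * norm (x1 + \<alpha> *\<^sub>R b1)"
    proof (rule davis_yin_norm_bound_right)
      show "0 \<le> x2 \<bullet> a1" using JB'_mono[of w1] params by (simp add: a1_def x2_def)
      show "0 \<le> x1 \<bullet> b1" using JA'_mono[of y] params by (simp add: b1_def x1_def)
      show "norm b1 \<le> L * norm x1"
        unfolding b1_def x1_def norm_scaleR
        using JA'_lip[of y] params by (simp add: pos_divide_le_eq mult_ac)
      show "\<beta> * (norm c1)\<^sup>2 \<le> x1 \<bullet> c1" "\<mu> * (norm x1)\<^sup>2 \<le> x1 \<bullet> c1"
        unfolding c1_def by (rule K'_coco K'_strong)+
      show "x1 - x2 = \<alpha> *\<^sub>R (a1 + b1 + c1)"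
        using params by (simp add: a1_def b1_def w1_def algebra_simps scaleR_2)
    qed (use params in auto)
    then show ?thesis
      unfolding y by (simp add: T'_def x1_def x2_def w1_def c1_def)
  qed
  \<comment> \<open>Moving each factor across the inner product reverses the composition, so
    \<open>JA'\<close> acts first. Only the interpolated values at \<open>z\<close>,
    \<open>w\<close> and \<open>xB\<close> enter on the left.\<close>
  have "t \<bullet> y = z \<bullet> T' y" for y
  proof -
    have "t \<bullet> y = z \<bullet> y - \<theta> * (JB z \<bullet> y) + \<theta> * (JA w \<bullet> y)"
      by (simp add: t_def JA JB inner_simps)
    also have "JA w \<bullet> y = 2 * (JB z \<bullet> JA' y) - z \<bullet> JA' y - \<alpha> * (K xB \<bullet> JA' y)"
      by (simp add: JA(2)[rule_format] w JB(1) K(1) inner_simps)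
    also have "K xB \<bullet> JA' y = JB z \<bullet> K' (JA' y)"
      by (simp add: K(2)[rule_format] JB(1))
    also have "z \<bullet> y - \<theta> * (JB z \<bullet> y)
        + \<theta> * (2 * (JB z \<bullet> JA' y) - z \<bullet> JA' y - \<alpha> * (JB z \<bullet> K' (JA' y))) = z \<bullet> T' y"
      by (simp add: T'_def inner_simps JB(2)[rule_format, symmetric] algebra_simps)
    finally show ?thesis .
  qed
  then have "norm t * norm t = z \<bullet> T' t"
    by (metis dot_square_norm power2_eq_square)
  also have "\<dots> \<le> norm z * norm (T' t)"
    by (rule norm_cauchy_schwarz)
  also have "\<dots> \<le> norm z * (davis_yin_rate \<alpha> \<beta> \<theta> \<mu> L * norm t)"
    by (intro mult_left_mono T'_bound) simp
  finally have "norm t * norm t \<le> davis_yin_rate \<alpha> \<beta> \<theta> \<mu> L * norm z * norm t"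
    by (simp add: mult_ac)
  \<comment> \<open>\<open>T'_bound\<close> also shows that the rate is not negative unless \<open>z = 0\<close>, which matters for \<open>t = 0\<close>\<close>
  moreover have "0 \<le> davis_yin_rate \<alpha> \<beta> \<theta> \<mu> L * norm z"
    using T'_bound[of z] norm_ge_zero[of "T' z"] by linarith
  ultimately have "norm t \<le> davis_yin_rate \<alpha> \<beta> \<theta> \<mu> L * norm z"
    by (cases "t = 0") auto
  then show ?thesis by (simp add: t_def z_def)
qed

section \<open>From graphs to differences of points\<close>

lemma op_add_iff: "(x, w) \<in> A +\<^sub>o B \<longleftrightarrow> (\<exists>u v. w = u + v \<and> (x, u) \<in> A \<and> (x, v) \<in> B)"
  by (auto simp: op_add_def)

lemma op_diff_iff: "(x, w) \<in> A -\<^sub>o B \<longleftrightarrow> (\<exists>u v. w = u - v \<and> (x, u) \<in> A \<and> (x, v) \<in> B)"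
  by (auto simp: op_diff_def)

lemma op_scale_iff: "(x, w) \<in> c *\<^sub>o A \<longleftrightarrow> (\<exists>u. w = c *\<^sub>R u \<and> (x, u) \<in> A)"
  by (auto simp: op_scale_def)

lemma resolvent_iff: "(z, x) \<in> resolvent (\<alpha> *\<^sub>o A) \<longleftrightarrow> (\<exists>a. (x, a) \<in> A \<and> z = x + \<alpha> *\<^sub>R a)"
  by (auto simp: resolvent_def op_add_def op_scale_def)

lemma single_valued_resolvent:
  assumes "0 < \<alpha>" "monotone_op A"
  shows "single_valued (resolvent (\<alpha> *\<^sub>o A))"
proof (rule single_valuedI)
  fix z x y
  assume "(z, x) \<in> resolvent (\<alpha> *\<^sub>o A)" "(z, y) \<in> resolvent (\<alpha> *\<^sub>o A)"
  then obtain a b where ab: "(x, a) \<in> A" "(y, b) \<in> A" "z = x + \<alpha> *\<^sub>R a" "z = y + \<alpha> *\<^sub>R b"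
    by (auto simp: resolvent_iff)
  then have "x - y = - (\<alpha> *\<^sub>R (a - b))" by (simp add: algebra_simps)
  then have "(x - y) \<bullet> (x - y) = - (\<alpha> * ((x - y) \<bullet> (a - b)))"
    by (metis inner_minus_right inner_scaleR_right)
  also have "\<dots> \<le> 0"
    using assms ab by (simp add: monotone_op_def)
  finally have "(x - y) \<bullet> (x - y) = 0"
    by (metis inner_ge_zero order_antisym)
  then show "x = y" by simp
qed

lemma davis_yinE:
  assumes "0 < \<alpha>" "monotone_op B" "(z, t) \<in> davis_yin A B C \<alpha> \<theta>"
  obtains xA xB a b c where "(xA, a) \<in> A" "(xB, b) \<in> B" "(xB, c) \<in> C"
    "z = xB + \<alpha> *\<^sub>R b" "t = xB + \<alpha> *\<^sub>R b - \<theta> *\<^sub>R xB + \<theta> *\<^sub>R xA"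
    "xB - xA = \<alpha> *\<^sub>R (a + b + c)"
proof -
  \<comment> \<open>The resolvent of \<open>B\<close> occurs three times, each time with its own
    witness; single-valuedness identifies them.\<close>
  from assms(3) obtain xB xB' xB'' xA c where x:
    "(z, xB) \<in> resolvent (\<alpha> *\<^sub>o B)" "(z, xB') \<in> resolvent (\<alpha> *\<^sub>o B)" "(z, xB'') \<in> resolvent (\<alpha> *\<^sub>o B)"
    "(xB'', c) \<in> C" "(2 *\<^sub>R xB' - z - \<alpha> *\<^sub>R c, xA) \<in> resolvent (\<alpha> *\<^sub>o A)"
    "t = z - \<theta> *\<^sub>R xB + \<theta> *\<^sub>R xA"
    by (auto simp: davis_yin_def Let_def op_add_iff op_diff_iff op_scale_iff op_comp_def
        relcomp_unfold)
  with single_valued_resolvent[OF assms(1,2)] have eq: "xB' = xB" "xB'' = xB"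
    by (auto dest: single_valuedD)
  from x obtain a b where ab: "(xB, b) \<in> B" "z = xB + \<alpha> *\<^sub>R b"
    "(xA, a) \<in> A" "2 *\<^sub>R xB' - z - \<alpha> *\<^sub>R c = xA + \<alpha> *\<^sub>R a"
    by (auto simp: resolvent_iff)
  show ?thesis
  proof (rule that)
    show "xB - xA = \<alpha> *\<^sub>R (a + b + c)"
      using ab eq by (simp add: algebra_simps scaleR_2)
  qed (use ab x eq in auto)
qed

lemma contractive_davis_yinI:
  assumes "0 < \<alpha>" "monotone_op B"
    and bound: "\<And>xA xB a b c xA' xB' a' b' c'.
      \<lbrakk>(xA, a) \<in> A; (xB, b) \<in> B; (xB, c) \<in> C; (xA', a') \<in> A; (xB', b') \<in> B; (xB', c') \<in> C;
       (xB - xB') - (xA - xA') = \<alpha> *\<^sub>R ((a - a') + (b - b') + (c - c'))\<rbrakk> \<Longrightarrow>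
      norm ((xB - xB') + \<alpha> *\<^sub>R (b - b') - \<theta> *\<^sub>R (xB - xB') + \<theta> *\<^sub>R (xA - xA'))
        \<le> \<rho> * norm ((xB - xB') + \<alpha> *\<^sub>R (b - b'))"
  shows "contractive_op \<rho> (davis_yin A B C \<alpha> \<theta>)"
proof -
  have *: "norm (t - t') \<le> \<rho> * norm (z - z')"
    if T: "(z, t) \<in> davis_yin A B C \<alpha> \<theta>" "(z', t') \<in> davis_yin A B C \<alpha> \<theta>" for z t z' t'
  proof -
    obtain xA xB a b c where 1: "(xA, a) \<in> A" "(xB, b) \<in> B" "(xB, c) \<in> C"
      "z = xB + \<alpha> *\<^sub>R b" "t = xB + \<alpha> *\<^sub>R b - \<theta> *\<^sub>R xB + \<theta> *\<^sub>R xA"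
      "xB - xA = \<alpha> *\<^sub>R (a + b + c)"
      by (rule davis_yinE[OF assms(1,2) T(1)])
    obtain xA' xB' a' b' c' where 2: "(xA', a') \<in> A" "(xB', b') \<in> B" "(xB', c') \<in> C"
      "z' = xB' + \<alpha> *\<^sub>R b'" "t' = xB' + \<alpha> *\<^sub>R b' - \<theta> *\<^sub>R xB' + \<theta> *\<^sub>R xA'"
      "xB' - xA' = \<alpha> *\<^sub>R (a' + b' + c')"
      by (rule davis_yinE[OF assms(1,2) T(2)])
    have "(xB - xB') - (xA - xA') = (xB - xA) - (xB' - xA')" by simp
    also have "\<dots> = \<alpha> *\<^sub>R ((a - a') + (b - b') + (c - c'))"
      unfolding 1(6) 2(6) by (simp add: algebra_simps)
    finally have "norm ((xB - xB') + \<alpha> *\<^sub>R (b - b') - \<theta> *\<^sub>R (xB - xB') + \<theta> *\<^sub>R (xA - xA'))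
        \<le> \<rho> * norm ((xB - xB') + \<alpha> *\<^sub>R (b - b'))"
      by (rule bound[OF 1(1-3) 2(1-3)])
    moreover have "(xB - xB') + \<alpha> *\<^sub>R (b - b') - \<theta> *\<^sub>R (xB - xB') + \<theta> *\<^sub>R (xA - xA') = t - t'"
      "(xB - xB') + \<alpha> *\<^sub>R (b - b') = z - z'"
      unfolding 1(4,5) 2(4,5) by (simp_all add: algebra_simps)
    ultimately show ?thesis by simp
  qed
  \<comment> \<open>For \<open>z = z'\<close> the bound \<open>*\<close> reads
    \<open>norm (t - t') \<le> 0\<close>, whatever \<open>\<rho>\<close> is.\<close>
  moreover have "single_valued (davis_yin A B C \<alpha> \<theta>)"
    using * by (fastforce intro!: single_valuedI)
  ultimately show ?thesis by (simp add: contractive_op_def)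
qed

theorem theorem3p3:
  fixes A B C :: "'h::{real_inner, complete_space} operator"
    and \<alpha> \<beta> \<theta> :: real
  assumes "0 < \<alpha>" and "\<alpha> < 4 * \<beta>"
    and "0 < \<theta>" and "\<theta> < 2 - \<alpha> / (2 * \<beta>)"
    and "monotone_op A" and "monotone_op B" and "cocoercive_op \<beta> C"
  shows
    "(\<forall>L\<^sub>A \<mu>\<^sub>C :: real.
        lipschitz_op L\<^sub>A A \<and> strongly_monotone_op \<mu>\<^sub>C C \<and> 0 < L\<^sub>A \<and> 0 < \<mu>\<^sub>C \<and> \<mu>\<^sub>C \<le> 1 / \<beta> \<longrightarrow>
        contractive_op
          (sqrt (1 - 2 * \<theta> * \<alpha> * min
            ((L\<^sub>A + \<mu>\<^sub>C * (1 - \<alpha> / (2 * \<beta> * (2 - \<theta>)))) / (1 + \<alpha> * L\<^sub>A)\<^sup>2)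
            (\<mu>\<^sub>C * (1 - \<alpha> / (2 * \<beta> * (2 - \<theta>))) / (1 + \<alpha>\<^sup>2 * L\<^sub>A\<^sup>2))))
          (davis_yin A B C \<alpha> \<theta>)) \<and>
     (\<forall>L\<^sub>B \<mu>\<^sub>C :: real.
        lipschitz_op L\<^sub>B B \<and> strongly_monotone_op \<mu>\<^sub>C C \<and> 0 < L\<^sub>B \<and> 0 < \<mu>\<^sub>C \<and> \<mu>\<^sub>C \<le> 1 / \<beta> \<longrightarrow>
        contractive_op
          (sqrt (1 - 2 * \<theta> * \<alpha> * min
            ((L\<^sub>B + \<mu>\<^sub>C * (1 - \<alpha> / (2 * \<beta> * (2 - \<theta>)))) / (1 + \<alpha> * L\<^sub>B)\<^sup>2)
            (\<mu>\<^sub>C * (1 - \<alpha> / (2 * \<beta> * (2 - \<theta>))) / (1 + \<alpha>\<^sup>2 * L\<^sub>B\<^sup>2))))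
          (davis_yin A B C \<alpha> \<theta>))"
  unfolding davis_yin_rate_def[symmetric]
proof (intro conjI allI impI; elim conjE)
  fix L \<mu> :: real
  assume hyps: "strongly_monotone_op \<mu> C" "0 < L" "0 < \<mu>" "\<mu> \<le> 1 / \<beta>"
  show "contractive_op (davis_yin_rate \<alpha> \<beta> \<theta> \<mu> L) (davis_yin A B C \<alpha> \<theta>)" if "lipschitz_op L A"
    using assms hyps that
    by (intro contractive_davis_yinI davis_yin_norm_bound_left)
      (auto simp: monotone_op_def lipschitz_op_def cocoercive_op_def strongly_monotone_op_def)
  show "contractive_op (davis_yin_rate \<alpha> \<beta> \<theta> \<mu> L) (davis_yin A B C \<alpha> \<theta>)" if "lipschitz_op L B"
    using assms hyps that
    by (intro contractive_davis_yinI davis_yin_norm_bound_right)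
      (auto simp: monotone_op_def lipschitz_op_def cocoercive_op_def strongly_monotone_op_def)
qed

end
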